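(* Let $$A=\{x=(x_n)_{n\in\mathbb{N}}\in\{0,1\}^{\mathbb{N}} : x_{2n}+x_{2n+1}=1 \text{ for all } n\in\mathbb{N}\}$$ and $$S=\left\{\sum_{n=1}^{+\infty}\frac{x_{n-1}}{10^{n!}} : x=(x_n)_{n\in\mathbb{N}}\in A\right\}\subset\mathbb{R}.$$ Then $S$ is a Cantor set contained in the set $\mathbb{L}$ of Liouville numbers.
   Context: $\mathbb{N}=\{0,1,2,\ldots\}$. A set $X\subset\mathbb{R}$ is nowhere dense if $\operatorname{int}(\overline{X})=\emptyset$. A set $C\subset\mathbb{R}$ is perfect if $C=C'$, where $C'$ is the set of all accumulation points of $C$ in $\mathbb{R}$. A Cantor set is a nonempty set $C\subset\mathbb{R}$ that is nowhere dense and perfect (this is the definition used; boundedness is not required). A number $\alpha\in\mathbb{R}\setminus\mathbb{Q}$ is a Liouville number if for all $n\in\mathbb{N}$ there exist integers $p,q$ (depending on $n$) with $q>1$ and $0<\left|\alpha-\frac{p}{q}\right|<\frac{1}{q^n}$. $\mathbb{L}$ denotes the set of Liouville numbers. *)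

theory Defs
  imports "HOL-Analysis.Analysis"
begin

definition nowhere_dense :: "real set \<Rightarrow> bool" where
  "nowhere_dense X \<longleftrightarrow> interior (closure X) = {}"

definition perfect :: "real set \<Rightarrow> bool" where
  "perfect C \<longleftrightarrow> C = {x. x islimpt C}"

(* Boundedness is deliberately not part of the definition. *)
definition cantor_set :: "real set \<Rightarrow> bool" where
  "cantor_set C \<longleftrightarrow> C \<noteq> {} \<and> nowhere_dense C \<and> perfect C"

definition liouville_numbers :: "real set" where
  "liouville_numbers =
    {\<alpha>. \<alpha> \<notin> \<rat> \<and>
      (\<forall>n::nat. \<exists>p q :: int. q > 1 \<and>
         0 < \<bar>\<alpha> - of_int p / of_int q\<bar> \<and>
         \<bar>\<alpha> - of_int p / of_int q\<bar> < 1 / of_int q ^ n)}"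

definition paired_binary_seqs :: "(nat \<Rightarrow> nat) set" where
  "paired_binary_seqs =
    {x. (\<forall>n. x n \<in> {0, 1}) \<and> (\<forall>n. x (2 * n) + x (2 * n + 1) = 1)}"

(* The series over n >= 1 with terms x_(n-1) / 10^(n!), reindexed to start at 0.
   By the lemma below, suminf is here the sum of a convergent series. *)
definition liouville_series :: "(nat \<Rightarrow> nat) \<Rightarrow> real" where
  "liouville_series x = (\<Sum>n. real (x n) / 10 ^ fact (n + 1))"

definition S_set :: "real set" where
  "S_set = {liouville_series x | x. x \<in> paired_binary_seqs}"

lemma summable_liouville_series:
  assumes "\<And>n. x n \<in> {0, 1}"
  shows "summable (\<lambda>n. real (x n) / 10 ^ fact (n + 1))"
proof (rule summable_comparison_test')
  show "summable (\<lambda>n. (1 / 10 :: real) ^ n)"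
    by (rule summable_geometric) simp
  fix n :: nat
  have "n \<le> fact (n + 1)"
    using fact_ge_self[of "n + 1"] by linarith
  then have "(10 :: real) ^ n \<le> 10 ^ fact (n + 1)"
    by (intro power_increasing) auto
  moreover have "real (x n) \<le> 1"
    using assms[of n] by auto
  ultimately have "real (x n) / 10 ^ fact (n + 1) \<le> 1 / 10 ^ n"
    by (intro frac_le) auto
  then show "norm (real (x n) / 10 ^ fact (n + 1)) \<le> (1 / 10) ^ n"
    by (simp add: power_one_over)
qed

end

theory Submission
  imports Defs
begin

text \<open>
  The exponents \<open>(n + 1)!\<close> grow so fast that a tail of the series is dominated by a geometric
  series starting at its first possible term: the tail from position \<open>N\<close> lies between \<open>0\<close> and
  \<open>(10/9) / 10 ^ (N + 1)!\<close> (lemma \<open>liouville_series_between\<close>). Everything about individual points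
  of the set follows from this bound.

  \<^item> Liouville property. The partial sum over \<open>n < N\<close> is a fraction with denominator
    \<open>q = 10 ^ N!\<close>, and \<open>10 ^ (N + 1)! = q ^ (N + 1)\<close>, so the partial sum approximates to any
    prescribed order. It is never exact, because each pair of digits contains a \<open>1\<close>. That
    numbers with such approximations are irrational is Liouville's classical argument.

  \<^item> No isolated points. Complementing all digits from an even position on stays within the
    admissible sequences. It moves the sum by at most a tail, and it does move it because the sum
    is strictly monotone in the lexicographic order of the digits.

  \<^item> Closedness. The admissible sequences form a compact subset of the product space, and the sum
    is continuous there as a uniform limit of its partial sums; hence its image is compact.

  \<^item> Nowhere density then needs no further estimate: a closed set of irrational numbers has empty
    interior, since the rationals are dense.
\<close>

section \<open>Tails of the series\<close>

lemma fact_plus_le_fact_add: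
  fixes m n :: nat
  assumes "m \<ge> 1"
  shows "fact m + n \<le> (fact (m + n) :: nat)"
proof (induction n)
  case 0
  then show ?case by simp
next
  case (Suc n)
  have "(2::nat) * fact (m + n) \<le> (m + n + 1) * fact (m + n)"
    using assms by (intro mult_right_mono) auto
  moreover have "(1::nat) \<le> fact (m + n)"
    by (rule fact_ge_1)
  moreover have "(fact (m + Suc n) :: nat) = (m + n + 1) * fact (m + n)"
    by simp
  ultimately show ?case
    using Suc.IH by linarith
qed

text \<open>
  By \<open>(N + 1)! + k \<le> (N + 1 + k)!\<close>, the tail is at most \<open>10 ^ -(N + 1)!\<close> times the geometric
  series \<open>\<Sum>k. 10 ^ -k = 10/9\<close>.
\<close>

lemma liouville_series_between:
  fixes x :: "nat \<Rightarrow> nat"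
  assumes x: "\<And>n. x n \<in> {0, 1}"
  defines "P \<equiv> \<lambda>N. \<Sum>n<N. real (x n) / 10 ^ fact (n + 1)"
  shows "P N \<le> liouville_series x"
    and "liouville_series x \<le> P N + (10 / 9) / 10 ^ fact (N + 1)"
proof -
  let ?f = "\<lambda>n. real (x n) / 10 ^ fact (n + 1)"
  have sf: "summable ?f"
    using x by (rule summable_liouville_series)
  have split: "liouville_series x = (\<Sum>n. ?f (n + N)) + P N"
    unfolding liouville_series_def P_def by (rule suminf_split_initial_segment[OF sf])
  have st: "summable (\<lambda>n. ?f (n + N))"
    using sf by (subst summable_iff_shift)
  have "0 \<le> (\<Sum>n. ?f (n + N))"
    by (rule suminf_nonneg[OF st]) simp
  then show "P N \<le> liouville_series x"
    using split by simp
  let ?g = "\<lambda>n. (1 / 10 ^ fact (N + 1)) * (1 / 10 :: real) ^ n"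
  have g: "?g sums ((1 / 10 ^ fact (N + 1)) * (1 / (1 - 1 / 10)))"
    by (intro sums_mult geometric_sums) simp
  have le: "?f (n + N) \<le> ?g n" for n
  proof -
    have "fact (N + 1) + n \<le> (fact (n + N + 1) :: nat)"
      using fact_plus_le_fact_add[of "N + 1" n] by (simp add: ac_simps)
    then have "(10::real) ^ (fact (N + 1) + n) \<le> 10 ^ fact (n + N + 1)"
      by (intro power_increasing) auto
    moreover have "real (x (n + N)) \<le> 1"
      using x[of "n + N"] by auto
    ultimately have "?f (n + N) \<le> 1 / 10 ^ (fact (N + 1) + n)"
      by (intro frac_le) auto
    also have "\<dots> = ?g n"
      by (simp add: power_add power_one_over)
    finally show ?thesis .
  qed
  have "(\<Sum>n. ?f (n + N)) \<le> (\<Sum>n. ?g n)"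
    by (rule suminf_le[OF le st sums_summable[OF g]])
  also have "\<dots> = (10 / 9) / 10 ^ fact (N + 1)"
    using sums_unique[OF g] by simp
  finally show "liouville_series x \<le> P N + (10 / 9) / 10 ^ fact (N + 1)"
    using split by simp
qed

text \<open>
  Strict monotonicity in the lexicographic order: a digit \<open>1\<close> outweighs everything that can follow
  a digit \<open>0\<close> in its place, since \<open>(10/9) / 10 ^ (N + 2)! < 1 / 10 ^ (N + 1)!\<close>.
\<close>

lemma liouville_series_less:
  fixes x y :: "nat \<Rightarrow> nat"
  assumes x: "\<And>n. x n \<in> {0, 1}" and y: "\<And>n. y n \<in> {0, 1}"
    and agree: "\<And>n. n < N \<Longrightarrow> x n = y n" and "x N = 0" "y N = 1"
  shows "liouville_series x < liouville_series y"
proof -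
  let ?P = "\<lambda>z M. \<Sum>n<M. real (z n) / 10 ^ fact (n + 1)"
  have same: "?P x N = ?P y N"
    using agree by (intro sum.cong) auto
  have "fact (N + 1) + 1 \<le> (fact (Suc N + 1) :: nat)"
    using fact_plus_le_fact_add[of "N + 1" 1] by simp
  then have "(10::real) ^ (fact (N + 1) + 1) \<le> 10 ^ fact (Suc N + 1)"
    by (rule power_increasing) simp
  then have "(10 / 9 :: real) / 10 ^ fact (Suc N + 1) \<le> (10 / 9) / 10 ^ (fact (N + 1) + 1)"
    by (intro divide_left_mono) auto
  also have "\<dots> < 1 / 10 ^ fact (N + 1)"
    by (simp add: field_simps)
  finally have small: "(10 / 9 :: real) / 10 ^ fact (Suc N + 1) < 1 / 10 ^ fact (N + 1)" .
  have "liouville_series x \<le> ?P x (Suc N) + (10 / 9) / 10 ^ fact (Suc N + 1)"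
    using x by (rule liouville_series_between)
  also have "\<dots> < ?P x (Suc N) + 1 / 10 ^ fact (N + 1)"
    using small by (rule add_strict_left_mono)
  also have "\<dots> = ?P y (Suc N)"
    using assms(4,5) same by simp
  also have "\<dots> \<le> liouville_series y"
    using y by (rule liouville_series_between)
  finally show ?thesis .
qed

section \<open>The sums are Liouville numbers\<close>

text \<open>
  Two distinct fractions with denominators \<open>b\<close> and \<open>q\<close> are at least \<open>1 / (b q)\<close> apart. For a fixed
  denominator \<open>b\<close> this contradicts approximation to within \<open>1 / q ^ n\<close> as soon as
  \<open>2 ^ (n - 1) \<ge> b\<close>; \<open>n = b + 1\<close> is enough.
\<close>

lemma irrational_if_approximable_to_all_orders:
  fixes \<alpha> :: real
  assumes approx: "\<And>n::nat. \<exists>p q :: int. q > 1 \<and> 0 < \<bar>\<alpha> - of_int p / of_int q\<bar> \<and>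
                     \<bar>\<alpha> - of_int p / of_int q\<bar> < 1 / of_int q ^ n"
  shows "\<alpha> \<notin> \<rat>"
proof
  assume "\<alpha> \<in> \<rat>"
  then obtain a b :: int where b: "b > 0" and ab: "\<alpha> = of_int a / of_int b"
    by (auto elim: Rats_cases')
  obtain p q :: int where q: "q > 1" and pos: "0 < \<bar>\<alpha> - of_int p / of_int q\<bar>"
    and less: "\<bar>\<alpha> - of_int p / of_int q\<bar> < 1 / of_int q ^ (nat b + 1)"
    using approx by blast
  have diff: "\<bar>\<alpha> - of_int p / of_int q\<bar> = of_int \<bar>a * q - p * b\<bar> / (of_int b * of_int q)"
    using b q by (simp add: ab diff_frac_eq abs_mult)
  have "a * q - p * b \<noteq> 0"
  proof
    assume "a * q - p * b = 0"
    then show False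
      using pos unfolding diff by simp
  qed
  then have "(1::real) \<le> of_int \<bar>a * q - p * b\<bar>"
    by linarith
  then have "1 / (of_int b * of_int q) \<le> \<bar>\<alpha> - of_int p / of_int q\<bar>"
    unfolding diff using b q by (intro divide_right_mono) auto
  with less have "1 / (of_int b * of_int q) < (1::real) / of_int q ^ (nat b + 1)"
    by linarith
  then have "real_of_int q ^ (nat b + 1) < of_int b * of_int q"
    using b q by (simp add: field_simps)
  then have "real_of_int q ^ nat b < of_int b"
    using q by simp
  moreover have "of_int b < (2::real) ^ nat b"
    using of_nat_less_two_power[of "nat b", where 'a = real] b by simp
  moreover have "(2::real) ^ nat b \<le> of_int q ^ nat b"
    using q by (intro power_mono) auto
  ultimately show False by linarith
qed

lemma partial_sum_eq_fraction:
  fixes x :: "nat \<Rightarrow> nat"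
  shows "(\<Sum>n<N. real (x n) / 10 ^ fact (n + 1)) =
         of_int (\<Sum>n<N. int (x n) * 10 ^ (fact N - fact (n + 1))) / of_int (10 ^ fact N)"
proof -
  have "real (x n) / 10 ^ fact (n + 1) =
        of_int (int (x n) * 10 ^ (fact N - fact (n + 1))) / of_int (10 ^ fact N)"
    if "n < N" for n
  proof -
    have "(fact (n + 1) :: nat) \<le> fact N"
      using that by (intro fact_mono) auto
    then have "(10::real) ^ fact N = 10 ^ (fact N - fact (n + 1)) * 10 ^ fact (n + 1)"
      by (simp flip: power_add)
    then show ?thesis
      by simp
  qed
  then show ?thesis
    by (simp add: sum_divide_distrib)
qed

text \<open>
  For infinitely many nonzero digits, the partial sums are strictly smaller than the sum, and
  \<open>q = 10 ^ N!\<close> satisfies \<open>(10/9) / q ^ (N + 1) < 1 / q ^ N\<close>. So order \<open>n\<close> is achieved by \<open>N = n\<close>,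
  including \<open>n = 0\<close>, where \<open>q = 10 ^ 0! = 10\<close> is still greater than \<open>1\<close>.
\<close>

lemma liouville_series_liouville_number:
  fixes x :: "nat \<Rightarrow> nat"
  assumes x: "\<And>n. x n \<in> {0, 1}" and inf: "\<And>N. \<exists>n\<ge>N. x n = 1"
  shows "liouville_series x \<in> liouville_numbers"
proof -
  let ?P = "\<lambda>N. \<Sum>n<N. real (x n) / 10 ^ fact (n + 1)"
  have approx: "\<exists>p q :: int. q > 1 \<and> 0 < \<bar>liouville_series x - of_int p / of_int q\<bar> \<and>
                \<bar>liouville_series x - of_int p / of_int q\<bar> < 1 / of_int q ^ n" for n
  proof -
    define p q :: int where
      "p = (\<Sum>k<n. int (x k) * 10 ^ (fact n - fact (k + 1)))" and "q = 10 ^ fact n"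
    have pq: "of_int p / of_int q = ?P n"
      unfolding p_def q_def by (rule partial_sum_eq_fraction[symmetric])
    have q: "q > 1"
      unfolding q_def by (rule one_less_power) auto
    obtain m where m: "m \<ge> n" "x m = 1"
      using inf by blast
    have "?P n \<le> ?P m"
      using m(1) by (intro sum_mono2) auto
    also have "\<dots> < ?P (Suc m)"
      using m(2) by simp
    also have "\<dots> \<le> liouville_series x"
      using x by (rule liouville_series_between)
    finally have lower: "?P n < liouville_series x" .
    have "liouville_series x - ?P n \<le> (10 / 9) / 10 ^ fact (n + 1)"
      using liouville_series_between(2)[where x = x and N = n, OF x] by linarith
    also have "\<dots> < 1 / of_int q ^ n"
    proof -
      have "(fact (n + 1) :: nat) = fact n * n + fact n"
        by (simp add: algebra_simps)
      moreover have "(1::nat) \<le> fact n"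
        by (rule fact_ge_1)
      ultimately have "fact n * n + 1 \<le> (fact (n + 1) :: nat)"
        by linarith
      then have "(10::real) ^ (fact n * n + 1) \<le> 10 ^ fact (n + 1)"
        by (rule power_increasing) simp
      then have "(10 / 9 :: real) / 10 ^ fact (n + 1) \<le> (10 / 9) / 10 ^ (fact n * n + 1)"
        by (intro divide_left_mono) auto
      also have "\<dots> < 1 / 10 ^ (fact n * n)"
        by (simp add: field_simps)
      finally show ?thesis
        by (simp add: q_def power_mult)
    qed
    finally show ?thesis
      using q lower by (intro exI[of _ p] exI[of _ q]) (simp add: pq)
  qed
  then show ?thesis
    unfolding liouville_numbers_def
    using irrational_if_approximable_to_all_orders[OF approx] by blast
qed

section \<open>The image set\<close>

lemma paired_binary_seqs_digit:
  assumes "x \<in> paired_binary_seqs"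
  shows "x n \<in> {0, 1}"
  using assms unfolding paired_binary_seqs_def by blast

lemma paired_binary_seqs_pair:
  assumes "x \<in> paired_binary_seqs"
  shows "x (2 * n) + x (2 * n + 1) = 1"
  using assms unfolding paired_binary_seqs_def by blast

lemma paired_binary_seqs_ones_unbounded:
  assumes "x \<in> paired_binary_seqs"
  shows "\<exists>n\<ge>N. x n = 1"
proof -
  have "x (2 * N) = 1 \<or> x (2 * N + 1) = 1"
    using paired_binary_seqs_pair[OF assms, of N] by linarith
  then show ?thesis
    by (auto intro: exI[of _ "2 * N"] exI[of _ "2 * N + 1"])
qed

lemma S_set_subset_liouville_numbers: "S_set \<subseteq> liouville_numbers"
  unfolding S_set_def
  using liouville_series_liouville_number paired_binary_seqs_digit
    paired_binary_seqs_ones_unbounded by blast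

lemma S_set_nonempty: "S_set \<noteq> {}"
proof -
  have "(\<lambda>n. n mod 2) \<in> paired_binary_seqs"
    unfolding paired_binary_seqs_def by auto
  then show ?thesis
    unfolding S_set_def by blast
qed

text \<open>
  Binary sequences form a compact space by Tychonoff's theorem, and the pair condition is closed
  because it only involves the coordinates, which are continuous.
\<close>

lemma compact_paired_binary_seqs: "compact paired_binary_seqs"
proof -
  have "compactin (product_topology (\<lambda>_::nat. euclidean :: nat topology) UNIV) (\<Pi>\<^sub>E n\<in>UNIV. {0, 1})"
    by (subst compactin_PiE) (auto simp: compactin_euclidean_iff)
  then have "compact (\<Pi>\<^sub>E n\<in>(UNIV::nat set). {0, 1 :: nat})"
    by (simp add: euclidean_product_topology compactin_euclidean_iff)
  moreover have "closed {x :: nat \<Rightarrow> nat. \<forall>n. x (2 * n) + x (2 * n + 1) = 1}"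
    by (intro closed_Collect_all closed_Collect_eq continuous_intros
        continuous_on_product_coordinates)
  moreover have "paired_binary_seqs =
      (\<Pi>\<^sub>E n\<in>UNIV. {0, 1}) \<inter> {x. \<forall>n. x (2 * n) + x (2 * n + 1) = 1}"
    unfolding paired_binary_seqs_def PiE_UNIV_domain Pi_def by blast
  ultimately show ?thesis
    by (elim ssubst) (rule compact_Int_closed)
qed

lemma continuous_on_liouville_series: "continuous_on paired_binary_seqs liouville_series"
proof -
  let ?f = "\<lambda>n (x :: nat \<Rightarrow> nat). real (x n) / 10 ^ fact (n + 1)"
  have "uniform_limit paired_binary_seqs (\<lambda>N x. \<Sum>n<N. ?f n x) (\<lambda>x. \<Sum>n. ?f n x) sequentially"
  proof (rule Weierstrass_m_test)
    show "summable (\<lambda>n. real ((\<lambda>_. 1) n) / 10 ^ fact (n + 1))"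
      by (rule summable_liouville_series) simp
    fix n x
    assume "x \<in> paired_binary_seqs"
    then show "norm (?f n x) \<le> real ((\<lambda>_. 1) n) / 10 ^ fact (n + 1)"
      using paired_binary_seqs_digit[of x n] by auto
  qed
  moreover have "continuous_on paired_binary_seqs (\<lambda>x. \<Sum>n<N. ?f n x)" for N
    by (intro continuous_intros continuous_on_subset[OF continuous_on_product_coordinates]) auto
  ultimately show ?thesis
    unfolding liouville_series_def
    by (intro uniform_limit_theorem[where F = sequentially]) auto
qed

lemma closed_S_set: "closed S_set"
proof -
  have "S_set = liouville_series ` paired_binary_seqs"
    unfolding S_set_def by auto
  then show ?thesis
    using compact_continuous_image[OF continuous_on_liouville_series compact_paired_binary_seqs]
    by (simp add: compact_imp_closed)
qed

text \<open>
  Complementing the digits from an even position \<open>2 N\<close> on respects the pairs. The new sum has the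
  same partial sum up to \<open>2 N\<close>, so it is close to the old one, but it differs from it by
  lexicographic monotonicity.
\<close>

lemma islimpt_S_set:
  assumes "s \<in> S_set"
  shows "s islimpt S_set"
  unfolding islimpt_approachable
proof (intro allI impI)
  fix e :: real
  assume e: "e > 0"
  obtain x where xA: "x \<in> paired_binary_seqs" and s: "s = liouville_series x"
    using assms unfolding S_set_def by blast
  obtain N where N: "(1 / 10 :: real) ^ N < e"
    using real_arch_pow_inv[OF e, of "1 / 10"] by auto
  define y where "y = (\<lambda>n. if n < 2 * N then x n else 1 - x n)"
  note x = paired_binary_seqs_digit[OF xA]
  have yA: "y \<in> paired_binary_seqs"
    unfolding paired_binary_seqs_def mem_Collect_eq
  proof (intro conjI allI)
    fix n
    show "y n \<in> {0, 1}"
      using x[of n] by (auto simp: y_def)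
    have "2 * n < 2 * N \<longleftrightarrow> 2 * n + 1 < 2 * N"
      by presburger
    then show "y (2 * n) + y (2 * n + 1) = 1"
      using paired_binary_seqs_pair[OF xA, of n] x[of "2 * n"]
      by (auto simp: y_def)
  qed
  note y = paired_binary_seqs_digit[OF yA]
  have agree: "x n = y n" if "n < 2 * N" for n
    using that by (simp add: y_def)
  have "liouville_series y \<noteq> s"
  proof (cases "x (2 * N) = 0")
    case True
    then have "y (2 * N) = 1" by (simp add: y_def)
    then show ?thesis
      using liouville_series_less[of x y "2 * N"] x y agree True s by simp
  next
    case False
    then have "x (2 * N) = 1" "y (2 * N) = 0"
      using x[of "2 * N"] by (auto simp: y_def)
    then show ?thesis
      using liouville_series_less[of y x "2 * N"] x y agree s by simp
  qed
  moreover have "dist (liouville_series y) s < e"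
  proof -
    let ?P = "\<lambda>z. \<Sum>n<2 * N. real (z n) / 10 ^ fact (n + 1)"
    have "?P x = ?P y"
      using agree by (intro sum.cong) auto
    then have "dist (liouville_series y) s \<le> (10 / 9) / 10 ^ fact (2 * N + 1)"
      using liouville_series_between[where x = x and N = "2 * N", OF x]
        liouville_series_between[where x = y and N = "2 * N", OF y]
      unfolding s dist_real_def by linarith
    also have "\<dots> \<le> (10 / 9) / 10 ^ (N + 1)"
    proof -
      have "N + 1 \<le> (fact (2 * N + 1) :: nat)"
        using fact_ge_self[of "2 * N + 1"] by linarith
      then have "(10::real) ^ (N + 1) \<le> 10 ^ fact (2 * N + 1)"
        by (rule power_increasing) simp
      then show ?thesis
        by (intro divide_left_mono) auto
    qed
    also have "\<dots> \<le> (1 / 10) ^ N"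
      by (simp add: field_simps)
    finally show ?thesis
      using N by linarith
  qed
  moreover have "liouville_series y \<in> S_set"
    using yA unfolding S_set_def by blast
  ultimately show "\<exists>t\<in>S_set. t \<noteq> s \<and> dist t s < e"
    by blast
qed

lemma nowhere_dense_if_closed_irrational:
  assumes "closed X" and "X \<inter> \<rat> = {}"
  shows "nowhere_dense X"
proof -
  have "interior X \<inter> \<rat> = {}"
    using assms(2) interior_subset by blast
  then have "interior X \<inter> closure \<rat> = {}"
    by (simp add: open_Int_closure_eq_empty)
  then show ?thesis
    using assms(1) by (simp add: nowhere_dense_def Rats_closure_real)
qed

theorem theorem2p1:
  shows "cantor_set S_set \<and> S_set \<subseteq> liouville_numbers"
proof -
  have "S_set \<inter> \<rat> = {}"
    using S_set_subset_liouville_numbers unfolding liouville_numbers_def by blast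
  then have "nowhere_dense S_set"
    using closed_S_set nowhere_dense_if_closed_irrational by blast
  moreover have "perfect S_set"
    using closed_S_set islimpt_S_set unfolding perfect_def closed_limpt by blast
  ultimately show ?thesis
    using S_set_nonempty S_set_subset_liouville_numbers unfolding cantor_set_def by blast
qed

end
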